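(* For each $i$, let $u_i^1,\dots,u_i^{L_i}$ enumerate $\{u_i\in\{0,1\}^T:A_iu_i\leq b_i\}$, and let $\underline M_{il},\overline M_{il}$ be sufficiently large constants. Then $(q_1,u_1,\dots,q_I,u_I)$ is a unit commitment constrained Nash equilibrium if and only if $$G_iq_i+H_iu_i\leq h_i,\quad A_iu_i\leq b_i,\quad u_i\in\{0,1\}^T,\quad i=1,\dots,I,$$ and there exist $q_i^l\in\mathbb{R}^T$ and $\lambda_i^l\in\mathbb{R}^m$, $l=1,\dots,L_i$, $i=1,\dots,I$, such that for all $l=1,\dots,L_i$, $i=1,\dots,I$: $$\sum_{t=1}^TP_{it}(q_{it},q_{-it})-\sum_{t=1}^TC_i(q_{it})-S_i(u_i)\geq \sum_{t=1}^TP_{it}(q_{it}^l,q_{-it})-\sum_{t=1}^TC_i(q_{it}^l)-S_i(u_i^l),$$ $$-\frac{\partial P_{it}}{\partial q_{it}}(q_{it}^l,q_{-it})+\frac{dC_i}{dq_{it}}(q_{it}^l)+(\lambda_{i}^l)^\top g_{it}=0,\ t=1,\dots,T,\qquad 0\leq \lambda_i^l\perp h_i-G_iq_i^l-H_iu_i^l\geq 0,$$ $$q_{it}^l-\underline{M}_{il}\Big(\sum_{s:u_{is}^l=1}(1-u_{is})+\sum_{s:u_{is}^l=0}u_{is}\Big)\leq q_{it}\leq q_{it}^l+\overline{M}_{il}\Big(\sum_{s:u_{is}^l=1}(1-u_{is})+\sum_{s:u_{is}^l=0}u_{is}\Big),\quad t=1,\dots,T.$$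
   Context: Let $I,T,m,n$ be positive integers. There are $I$ producers, each operating one unit $i=1,\dots,I$ over time periods $t=1,\dots,T$. Producer $i$ chooses $q_i=(q_{i1},\dots,q_{iT})^\top\in\mathbb{R}^T$ and $u_i=(u_{i1},\dots,u_{iT})^\top\in\{0,1\}^T$. Write $q_{-i}=(q_k)_{k\ne i}$ and $q_{-it}=(q_{kt})_{k\neq i}$. The revenue function $P_{it}(q_{it},q_{-it})$ is real-valued, and concave and continuously differentiable in $q_{it}$. For each $i$, $C_i:\mathbb{R}\to\mathbb{R}$ is convex and continuously differentiable, $S_i:\mathbb{R}^T\to\mathbb{R}$ is continuous, $A_i\in\mathbb{R}^{n\times T}$, $b_i\in\mathbb{R}^n$, $G_i,H_i\in\mathbb{R}^{m\times T}$, $h_i\in\mathbb{R}^m$, and $g_{it}$ is the $t$-th column of $G_i$. The notation $0\le x\perp y\ge 0$ means $x,y\ge 0$ componentwise and $x^\top y=0$. Definition. $(q_1,u_1,\dots,q_I,u_I)$ is a unit commitment constrained Nash equilibrium if for every $i=1,\dots,I$, given $q_{-i}$, the pair $(q_i,u_i)$ is an optimal solution to $$\max_{q_i,u_i}\Big\{\sum_{t=1}^TP_{it}(q_{it},q_{-it})-\sum_{t=1}^TC_i(q_{it})-S_i(u_i) : G_iq_i+H_iu_i\leq h_i,\ A_iu_i\leq b_i,\ u_i\in\{0,1\}^T\Big\}.$$ As a standing assumption, a producer's problem is feasible and bounded such that it has an optimal solution.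
   Formalization: Added assumption: for every i and every enumerated commitment u_i^l there is some q_i with G_i q_i + H_i u_i^l ≤ h_i; without it the right-hand side can be unsolvable although an equilibrium exists. *)

theory Defs
  imports "HOL-Analysis.Analysis"
begin

text \<open>
  Producers, time periods and constraint rows are indexed by the finite types \<open>'i\<close>, \<open>'t\<close>, \<open>'m\<close>, \<open>'n\<close>.
  The revenue \<open>P i t x y\<close> takes the rivals' quantities as a family \<open>y\<close> over \<open>- {i}\<close>, i.e. as an element
  of \<open>extensional (- {i})\<close>, so it cannot depend on producer \<open>i\<close>'s entry of the profile.
\<close>

definition rivals :: "'i \<Rightarrow> 't \<Rightarrow> ('i \<Rightarrow> real ^ 't) \<Rightarrow> 'i \<Rightarrow> real" where
  "rivals i t q = (\<lambda>k\<in>- {i}. q k $ t)"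

definition profit ::
  "('i \<Rightarrow> 't::finite \<Rightarrow> real \<Rightarrow> ('i \<Rightarrow> real) \<Rightarrow> real) \<Rightarrow> ('i \<Rightarrow> real \<Rightarrow> real) \<Rightarrow> ('i \<Rightarrow> real ^ 't \<Rightarrow> real)
    \<Rightarrow> 'i \<Rightarrow> ('i \<Rightarrow> real ^ 't) \<Rightarrow> real ^ 't \<Rightarrow> real ^ 't \<Rightarrow> real" where
  "profit P C S i q x v =
    (\<Sum>t\<in>UNIV. P i t (x $ t) (rivals i t q)) - (\<Sum>t\<in>UNIV. C i (x $ t)) - S i v"

definition binary_vector :: "real ^ 't \<Rightarrow> bool" where
  "binary_vector v \<longleftrightarrow> (\<forall>t. v $ t \<in> {0, 1})"

definition commitments ::
  "('i \<Rightarrow> real ^ 't ^ 'n) \<Rightarrow> ('i \<Rightarrow> real ^ 'n) \<Rightarrow> 'i \<Rightarrow> (real ^ 't) set" where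
  "commitments A b i = {v. A i *v v \<le> b i \<and> binary_vector v}"

definition producer_feasible ::
  "('i \<Rightarrow> real ^ 't ^ 'm) \<Rightarrow> ('i \<Rightarrow> real ^ 't ^ 'm) \<Rightarrow> ('i \<Rightarrow> real ^ 'm)
    \<Rightarrow> ('i \<Rightarrow> real ^ 't ^ 'n) \<Rightarrow> ('i \<Rightarrow> real ^ 'n) \<Rightarrow> 'i \<Rightarrow> real ^ 't \<Rightarrow> real ^ 't \<Rightarrow> bool" where
  "producer_feasible G H h A b i x v \<longleftrightarrow>
    G i *v x + H i *v v \<le> h i \<and> A i *v v \<le> b i \<and> binary_vector v"

definition producer_optimal ::
  "('i \<Rightarrow> 't::finite \<Rightarrow> real \<Rightarrow> ('i \<Rightarrow> real) \<Rightarrow> real) \<Rightarrow> ('i \<Rightarrow> real \<Rightarrow> real) \<Rightarrow> ('i \<Rightarrow> real ^ 't \<Rightarrow> real)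
    \<Rightarrow> ('i \<Rightarrow> real ^ 't ^ 'm) \<Rightarrow> ('i \<Rightarrow> real ^ 't ^ 'm) \<Rightarrow> ('i \<Rightarrow> real ^ 'm)
    \<Rightarrow> ('i \<Rightarrow> real ^ 't ^ 'n) \<Rightarrow> ('i \<Rightarrow> real ^ 'n)
    \<Rightarrow> 'i \<Rightarrow> ('i \<Rightarrow> real ^ 't) \<Rightarrow> real ^ 't \<Rightarrow> real ^ 't \<Rightarrow> bool" where
  "producer_optimal P C S G H h A b i q x v \<longleftrightarrow>
    is_arg_max (\<lambda>(y, w). profit P C S i q y w) (\<lambda>(y, w). producer_feasible G H h A b i y w) (x, v)"

definition uc_nash_equilibrium ::
  "('i \<Rightarrow> 't::finite \<Rightarrow> real \<Rightarrow> ('i \<Rightarrow> real) \<Rightarrow> real) \<Rightarrow> ('i \<Rightarrow> real \<Rightarrow> real) \<Rightarrow> ('i \<Rightarrow> real ^ 't \<Rightarrow> real)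
    \<Rightarrow> ('i \<Rightarrow> real ^ 't ^ 'm) \<Rightarrow> ('i \<Rightarrow> real ^ 't ^ 'm) \<Rightarrow> ('i \<Rightarrow> real ^ 'm)
    \<Rightarrow> ('i \<Rightarrow> real ^ 't ^ 'n) \<Rightarrow> ('i \<Rightarrow> real ^ 'n)
    \<Rightarrow> ('i \<Rightarrow> real ^ 't) \<Rightarrow> ('i \<Rightarrow> real ^ 't) \<Rightarrow> bool" where
  "uc_nash_equilibrium P C S G H h A b q u \<longleftrightarrow>
    (\<forall>i. producer_optimal P C S G H h A b i q (q i) (u i))"

definition complementary :: "real ^ 'm \<Rightarrow> real ^ 'm \<Rightarrow> bool" where
  "complementary x y \<longleftrightarrow> 0 \<le> x \<and> 0 \<le> y \<and> x \<bullet> y = 0"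

definition mismatch :: "real ^ 't \<Rightarrow> real ^ 't \<Rightarrow> real" where
  "mismatch v w = (\<Sum>s | v $ s = 1. 1 - w $ s) + (\<Sum>s | v $ s = 0. w $ s)"

end

theory Submission
  imports Defs
begin

text \<open>
  For a fixed commitment the dispatch problem is convex with linear constraints, so by Farkas' lemma the
  multiplier system characterises its optimal solutions. The big-M bounds force the profile to solve the
  system of its own commitment, where the mismatch vanishes, and the profit inequalities compare it with
  every other commitment.

  The delicate point is that one \<open>M\<^sub>0\<close> must serve all rival profiles. The costs depend on the rivals but are
  separable over time, and separable convex programs enjoy a proximity property: if \<open>x\<close> is optimal for
  the right-hand side \<open>b\<close>, then any feasible program with right-hand side \<open>b'\<close> has an optimal solution
  within a distance of \<open>x\<close> that depends only on the constraint matrix and on \<open>b - b'\<close>. To see this, split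
  \<open>y - x\<close>, for \<open>y\<close> feasible for \<open>b'\<close>, into generators of the cone of vectors with the same signs, both
  of the coordinates and of the constraint rows. If \<open>y\<close> is far from \<open>x\<close>, some summand is so large that
  half of it can be moved from \<open>y\<close> to \<open>x\<close> without losing feasibility on either side, which brings \<open>y\<close>
  closer without raising its cost. This also yields existence of an optimal solution for \<open>b'\<close>.
\<close>

section \<open>Sign cones and a large summand of a long vector\<close>

definition norm1 :: "real ^ 't::finite \<Rightarrow> real" where
  "norm1 x = (\<Sum>t\<in>UNIV. \<bar>x $ t\<bar>)"

lemma norm1_nonneg: "0 \<le> norm1 x"
  by (simp add: norm1_def sum_nonneg)

lemma component_le_norm1: "\<bar>x $ t\<bar> \<le> norm1 x"
  unfolding norm1_def by (rule member_le_sum) auto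

lemma norm_le_norm1: "norm x \<le> norm1 x"
  by (simp add: norm1_def norm_le_l1_cart)

lemma continuous_on_norm1: "continuous_on A (\<lambda>x. norm1 (x - a))"
  unfolding norm1_def by (intro continuous_intros)

text \<open>\<open>J\<close> and \<open>R\<close> prescribe weak signs for the coordinates and for
  the rows of \<open>G *v z\<close>. The finitely many cones of this form cover the space, and
  vectors of one cone add up without cancellation in any coordinate or row.\<close>

definition sign_cone :: "real ^ 't::finite ^ 'm::finite \<Rightarrow> 't set \<Rightarrow> 'm set \<Rightarrow> (real ^ 't) set" where
  "sign_cone G J R = {z. (\<forall>t. if t \<in> J then 0 \<le> z $ t else z $ t \<le> 0) \<and>
    (\<forall>j. if j \<in> R then 0 \<le> (G *v z) $ j else (G *v z) $ j \<le> 0)}"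

lemma sign_cone_add: "x \<in> sign_cone G J R \<Longrightarrow> y \<in> sign_cone G J R \<Longrightarrow> x + y \<in> sign_cone G J R"
  unfolding sign_cone_def
  by (auto simp: matrix_vector_right_distrib add_nonpos_nonpos split: if_splits)

lemma sign_cone_scaleR: "x \<in> sign_cone G J R \<Longrightarrow> 0 \<le> c \<Longrightarrow> c *\<^sub>R x \<in> sign_cone G J R"
  unfolding sign_cone_def
  by (auto simp: matrix_vector_mult_scaleR mult_nonneg_nonpos split: if_splits)

lemma zero_in_sign_cone: "0 \<in> sign_cone G J R"
  by (simp add: sign_cone_def)

lemma sign_cone_sum: "finite A \<Longrightarrow> (\<And>v. v \<in> A \<Longrightarrow> g v \<in> sign_cone G J R) \<Longrightarrow> sum g A \<in> sign_cone G J R"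
  by (induction A rule: finite_induct) (auto simp: zero_in_sign_cone intro: sign_cone_add)

lemma polyhedron_sign_cone: "polyhedron (sign_cone G J R)"
proof -
  have "sign_cone G J R =
      \<Inter> (range (\<lambda>t. {z. axis t (if t \<in> J then -1 else 1) \<bullet> z \<le> 0})) \<inter>
      \<Inter> (range (\<lambda>j. {z. (if j \<in> R then - row j G else row j G) \<bullet> z \<le> 0}))"
    by (auto simp: sign_cone_def inner_axis' matrix_vector_mul_component row_def split: if_splits)
  moreover have "polyhedron \<dots>"
    by (intro polyhedron_Int polyhedron_Inter) (auto simp: polyhedron_halfspace_le)
  ultimately show ?thesis by simp
qed

text \<open>Inside one cone all signs are fixed, so \<open>norm1\<close> agrees there with the
  linear functional given by \<open>s\<close>, and the unit slice is a bounded polyhedron. Finitely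
  many points spanning it as a convex hull generate the cone.\<close>

lemma polytope_sign_cone_base: "polytope (sign_cone G J R \<inter> {z. norm1 z = 1})"
proof -
  define s where "s = (\<chi> t. if t \<in> J then 1 else (- 1 :: real))"
  have "norm1 z = s \<bullet> z" if "z \<in> sign_cone G J R" for z
    unfolding norm1_def inner_vec_def
    using that by (intro sum.cong) (auto simp: s_def sign_cone_def)
  then have "sign_cone G J R \<inter> {z. norm1 z = 1} = sign_cone G J R \<inter> {z. s \<bullet> z = 1}"
    by auto
  then have "polyhedron (sign_cone G J R \<inter> {z. norm1 z = 1})"
    by (simp add: polyhedron_Int polyhedron_sign_cone polyhedron_hyperplane)
  moreover have "bounded (sign_cone G J R \<inter> {z. norm1 z = 1})"
    by (rule boundedI[of _ 1]) (use norm_le_norm1 in \<open>metis IntD2 mem_Collect_eq\<close>)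
  ultimately show ?thesis
    by (simp add: polytope_eq_bounded_polyhedron)
qed

text \<open>Scaled to norm 1, \<open>d\<close> is a convex combination of the finite set
  \<open>V\<close>, so one coefficient is at least \<open>1 / card V\<close>. The summand it belongs
  to grows with \<open>norm1 d\<close>, and so does every row value that does not vanish on its
  generator.\<close>

lemma sign_cone_large_part:
  fixes G :: "real ^ 't::finite ^ 'm::finite"
  obtains K where "\<And>d. d \<in> sign_cone G J R \<Longrightarrow> K < norm1 d \<Longrightarrow>
    \<exists>e. e \<noteq> 0 \<and> e \<in> sign_cone G J R \<and> d - 2 *\<^sub>R e \<in> sign_cone G J R \<and>
      (\<forall>j. (G *v e) $ j = 0 \<or> \<delta> \<le> \<bar>(G *v e) $ j\<bar>)"
proof -
  obtain V where V: "finite V" "sign_cone G J R \<inter> {z. norm1 z = 1} = convex hull V"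
    using polytope_sign_cone_base unfolding polytope_def by blast
  have V_sub: "v \<in> sign_cone G J R" "norm1 v = 1" if "v \<in> V" for v
    using hull_inc[OF that, of convex] V(2) by blast+
  \<comment> \<open>\<open>c\<close> will be the least nonzero absolute row value of the generators,
    capped at 1; the element 1 keeps the set nonempty when all row values vanish.\<close>
  define W where "W = insert 1 ((\<lambda>(v, j). \<bar>(G *v v) $ j\<bar>) ` (V \<times> UNIV) - {0})"
  define c where "c = Min W"
  have finW: "finite W" using V(1) by (simp add: W_def)
  have W_pos: "w > 0" if "w \<in> W" for w using that by (auto simp: W_def)
  have c_pos: "c > 0" unfolding c_def using finW W_pos by (subst Min_gr_iff) (auto simp: W_def)
  have c_le: "c \<le> \<bar>(G *v v) $ j\<bar>" if "v \<in> V" "(G *v v) $ j \<noteq> 0" for v j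
    unfolding c_def using that finW by (intro Min_le) (force simp: W_def)+
  show ?thesis
  proof (rule that)
    \<comment> \<open>The threshold makes \<open>N * (1 / card V) / 2 * c\<close> exceed
      \<open>\<delta>\<close>; the maximum with 0 lets \<open>d\<close> be normalised.\<close>
    fix d assume d: "d \<in> sign_cone G J R" and large: "max 0 (2 * \<delta> * card V / c) < norm1 d"
    define N where "N = norm1 d"
    have N: "N > 0" "2 * \<delta> * card V / c < N" using large by (auto simp: N_def)
    have "norm1 ((1 / N) *\<^sub>R d) = 1"
      using N(1) by (simp add: norm1_def abs_mult flip: sum_divide_distrib) (simp add: N_def norm1_def)
    then have "(1 / N) *\<^sub>R d \<in> convex hull V"
      using d N(1) by (auto simp flip: V(2) intro: sign_cone_scaleR)
    then obtain u where u: "\<And>v. v \<in> V \<Longrightarrow> 0 \<le> u v" "sum u V = 1"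
        "(\<Sum>v\<in>V. u v *\<^sub>R v) = (1 / N) *\<^sub>R d"
      unfolding convex_hull_finite[OF V(1)] by auto
    have "V \<noteq> {}" using u(2) by auto
    then have cardV: "card V > 0" using V(1) by (simp add: card_gt_0_iff)
    obtain v where v: "v \<in> V" "1 / card V \<le> u v"
    proof (rule ccontr)
      assume "\<not> thesis"
      then have "\<And>v. v \<in> V \<Longrightarrow> u v < 1 / card V" using that by force
      then have "sum u V < (\<Sum>v\<in>V. 1 / card V)"
        using V(1) \<open>V \<noteq> {}\<close> by (intro sum_strict_mono) auto
      then show False using u(2) cardV by simp
    qed
    have uv: "u v > 0" by (rule less_le_trans[OF _ v(2)]) (use cardV in simp)
    \<comment> \<open>Half of the summand at \<open>v\<close>, so that
      \<open>d - 2 *\<^sub>R e\<close> is the combination of the other generators.\<close>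
    define e where "e = (N * u v / 2) *\<^sub>R v"
    have "d = N *\<^sub>R (\<Sum>v\<in>V. u v *\<^sub>R v)" using N(1) u(3) by simp
    also have "\<dots> = N *\<^sub>R (u v *\<^sub>R v + (\<Sum>w\<in>V - {v}. u w *\<^sub>R w))"
      by (simp add: sum.remove[OF V(1) v(1)])
    finally have "d - 2 *\<^sub>R e = N *\<^sub>R (\<Sum>w\<in>V - {v}. u w *\<^sub>R w)"
      by (simp add: e_def algebra_simps)
    then have rest: "d - 2 *\<^sub>R e \<in> sign_cone G J R"
      using N(1) V(1) u(1) V_sub(1) by (auto intro!: sign_cone_scaleR sign_cone_sum)
    have "e \<noteq> 0" using N(1) uv V_sub(2)[OF v(1)] by (auto simp: e_def norm1_def)
    moreover have "e \<in> sign_cone G J R"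
      unfolding e_def using N(1) uv V_sub(1)[OF v(1)] by (intro sign_cone_scaleR) auto
    moreover have "(G *v e) $ j = 0 \<or> \<delta> \<le> \<bar>(G *v e) $ j\<bar>" for j
    proof (cases "(G *v v) $ j = 0")
      case False
      have "\<delta> \<le> (N * (1 / card V) / 2) * c"
        using N(2) c_pos cardV by (simp add: field_simps)
      also have "\<dots> \<le> (N * u v / 2) * \<bar>(G *v v) $ j\<bar>"
        using N(1) v(2) uv c_pos c_le[OF v(1) False] by (intro mult_mono divide_right_mono) auto
      also have "\<dots> = \<bar>(G *v e) $ j\<bar>"
        using N(1) uv by (simp add: e_def matrix_vector_mult_scaleR abs_mult)
      finally show ?thesis by simp
    qed (simp add: e_def matrix_vector_mult_scaleR)
    ultimately show "\<exists>e. e \<noteq> 0 \<and> e \<in> sign_cone G J R \<and> d - 2 *\<^sub>R e \<in> sign_cone G J R \<and>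
      (\<forall>j. (G *v e) $ j = 0 \<or> \<delta> \<le> \<bar>(G *v e) $ j\<bar>)"
      using rest by blast
  qed
qed

text \<open>The maximum of the bounds for the finitely many sign cones serves every direction
  \<open>d\<close>. In a row where \<open>e\<close> moves, it moves by at least
  \<open>\<delta>\<close> and by at most half of the change along \<open>d\<close>: this is the room
  needed to shift both ends by \<open>e\<close> under right-hand sides that differ by up to
  \<open>\<delta>\<close>.\<close>

lemma conformal_large_part:
  fixes G :: "real ^ 't::finite ^ 'm::finite"
  obtains K where "0 \<le> K" "\<And>d. K < norm1 d \<Longrightarrow>
    \<exists>e. e \<noteq> 0 \<and> (\<forall>t. 0 \<le> e $ t \<and> e $ t \<le> d $ t \<or> d $ t \<le> e $ t \<and> e $ t \<le> 0) \<and>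
      (\<forall>j. (G *v e) $ j = 0 \<or>
        \<delta> \<le> (G *v e) $ j \<and> 0 \<le> (G *v e) $ j \<and> 2 * (G *v e) $ j \<le> (G *v d) $ j \<or>
        (G *v e) $ j \<le> - \<delta> \<and> (G *v e) $ j \<le> 0 \<and> (G *v d) $ j \<le> 2 * (G *v e) $ j)"
proof -
  have "\<exists>K. \<forall>d\<in>sign_cone G J R. K < norm1 d \<longrightarrow>
    (\<exists>e. e \<noteq> 0 \<and> e \<in> sign_cone G J R \<and> d - 2 *\<^sub>R e \<in> sign_cone G J R \<and>
      (\<forall>j. (G *v e) $ j = 0 \<or> \<delta> \<le> \<bar>(G *v e) $ j\<bar>))" for J R
    using sign_cone_large_part[of G J R \<delta>] by metis
  then obtain k where k: "\<And>J R d. d \<in> sign_cone G J R \<Longrightarrow> k J R < norm1 d \<Longrightarrow>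
    \<exists>e. e \<noteq> 0 \<and> e \<in> sign_cone G J R \<and> d - 2 *\<^sub>R e \<in> sign_cone G J R \<and>
      (\<forall>j. (G *v e) $ j = 0 \<or> \<delta> \<le> \<bar>(G *v e) $ j\<bar>)"
    by metis
  define K where "K = Max (insert 0 (range (\<lambda>(J, R). k J R)))"
  have kK: "k J R \<le> K" for J R
    unfolding K_def by (intro Max_ge) (auto intro!: image_eqI[of _ _ "(J, R)"])
  have "0 \<le> K" unfolding K_def by (intro Max_ge) auto
  then show ?thesis
  proof (rule that)
    fix d :: "real ^ 't" assume d: "K < norm1 d"
    define J where "J = {t. 0 \<le> d $ t}"
    define R where "R = {j. 0 \<le> (G *v d) $ j}"
    have "d \<in> sign_cone G J R" by (auto simp: sign_cone_def J_def R_def)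
    then obtain e where e: "e \<noteq> 0" "e \<in> sign_cone G J R" "d - 2 *\<^sub>R e \<in> sign_cone G J R"
        "\<And>j. (G *v e) $ j = 0 \<or> \<delta> \<le> \<bar>(G *v e) $ j\<bar>"
      using k kK d by (meson le_less_trans)
    have sgn_t: "0 \<le> e $ t \<and> 2 * e $ t \<le> d $ t \<or> d $ t \<le> 2 * e $ t \<and> e $ t \<le> 0" for t
      using e(2,3) by (cases "t \<in> J") (auto simp: sign_cone_def dest!: spec[of _ t])
    have "0 \<le> e $ t \<and> e $ t \<le> d $ t \<or> d $ t \<le> e $ t \<and> e $ t \<le> 0" for t
      using sgn_t[of t] by linarith
    moreover have "0 \<le> (G *v e) $ j \<and> 2 * (G *v e) $ j \<le> (G *v d) $ j \<or>
        (G *v d) $ j \<le> 2 * (G *v e) $ j \<and> (G *v e) $ j \<le> 0" for j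
      using e(2,3) by (cases "j \<in> R")
        (auto simp: sign_cone_def matrix_vector_mult_diff_distrib matrix_vector_mult_scaleR dest!: spec[of _ j])
    then have "(G *v e) $ j = 0 \<or>
        \<delta> \<le> (G *v e) $ j \<and> 0 \<le> (G *v e) $ j \<and> 2 * (G *v e) $ j \<le> (G *v d) $ j \<or>
        (G *v e) $ j \<le> - \<delta> \<and> (G *v e) $ j \<le> 0 \<and> (G *v d) $ j \<le> 2 * (G *v e) $ j" for j
      using e(4)[of j] by (smt (verit))
    ultimately show "\<exists>e. e \<noteq> 0 \<and> (\<forall>t. 0 \<le> e $ t \<and> e $ t \<le> d $ t \<or> d $ t \<le> e $ t \<and> e $ t \<le> 0) \<and>
      (\<forall>j. (G *v e) $ j = 0 \<or>
        \<delta> \<le> (G *v e) $ j \<and> 0 \<le> (G *v e) $ j \<and> 2 * (G *v e) $ j \<le> (G *v d) $ j \<or>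
        (G *v e) $ j \<le> - \<delta> \<and> (G *v e) $ j \<le> 0 \<and> (G *v d) $ j \<le> 2 * (G *v e) $ j)"
      using e(1) by blast
  qed
qed

section \<open>Proximity of optimal solutions of separable convex programs\<close>

lemma convex_on_shift_inwards:
  fixes \<phi> :: "real \<Rightarrow> real"
  assumes "convex_on UNIV \<phi>" and e: "0 \<le> e \<and> e \<le> y - x \<or> y - x \<le> e \<and> e \<le> 0"
  shows "\<phi> (x + e) + \<phi> (y - e) \<le> \<phi> x + \<phi> y"
proof (cases "y = x")
  case False
  \<comment> \<open>\<open>x + e\<close> and \<open>y - e\<close> are convex combinations of
    \<open>x\<close> and \<open>y\<close> with the weights interchanged, so the two convexity bounds
    add up to \<open>\<phi> x + \<phi> y\<close>.\<close>
  define s where "s = e / (y - x)"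
  have s: "0 \<le> s" "s \<le> 1" and es: "e = s * (y - x)"
    using e False by (auto simp: s_def divide_simps)
  have "\<phi> ((1 - s) *\<^sub>R x + s *\<^sub>R y) \<le> (1 - s) * \<phi> x + s * \<phi> y"
    using convex_onD[OF assms(1)] s by simp
  moreover have "\<phi> ((1 - s) *\<^sub>R y + s *\<^sub>R x) \<le> (1 - s) * \<phi> y + s * \<phi> x"
    using convex_onD[OF assms(1)] s by simp
  moreover have "(1 - s) *\<^sub>R x + s *\<^sub>R y = x + e" "(1 - s) *\<^sub>R y + s *\<^sub>R x = y - e"
    by (simp_all add: es algebra_simps)
  ultimately show ?thesis by (simp add: algebra_simps)
qed (use e in auto)

definition separable :: "('t::finite \<Rightarrow> real \<Rightarrow> real) \<Rightarrow> real ^ 't \<Rightarrow> real" where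
  "separable f x = (\<Sum>t\<in>UNIV. f t (x $ t))"

text \<open>Moving from \<open>x\<close> by \<open>e\<close> stays feasible for \<open>b\<close>, moving back from \<open>y\<close> by \<open>e\<close> stays feasible for
  \<open>b'\<close>, and together the two moves do not increase the cost; as \<open>x\<close> is optimal, the move back alone does not.\<close>

lemma separable_closer_point:
  fixes G :: "real ^ 't::finite ^ 'm::finite"
  obtains K where "0 \<le> K"
    "\<And>(f :: 't \<Rightarrow> real \<Rightarrow> real) b b' x y. (\<And>t. convex_on UNIV (f t)) \<Longrightarrow> (\<And>j. \<bar>b $ j - b' $ j\<bar> \<le> \<delta>) \<Longrightarrow>
      is_arg_min (separable f) (\<lambda>z. G *v z \<le> b) x \<Longrightarrow> G *v y \<le> b' \<Longrightarrow> K < norm1 (y - x) \<Longrightarrow>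
      \<exists>z. G *v z \<le> b' \<and> separable f z \<le> separable f y \<and> norm1 (z - x) < norm1 (y - x)"
proof -
  obtain K where K: "0 \<le> K" "\<And>d. K < norm1 d \<Longrightarrow>
    \<exists>e. e \<noteq> 0 \<and> (\<forall>t. 0 \<le> e $ t \<and> e $ t \<le> d $ t \<or> d $ t \<le> e $ t \<and> e $ t \<le> 0) \<and>
      (\<forall>j. (G *v e) $ j = 0 \<or>
        \<delta> \<le> (G *v e) $ j \<and> 0 \<le> (G *v e) $ j \<and> 2 * (G *v e) $ j \<le> (G *v d) $ j \<or>
        (G *v e) $ j \<le> - \<delta> \<and> (G *v e) $ j \<le> 0 \<and> (G *v d) $ j \<le> 2 * (G *v e) $ j)"
    using conformal_large_part[of G \<delta>] by blast
  show ?thesis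
  proof (rule that[OF K(1)])
    fix f :: "'t \<Rightarrow> real \<Rightarrow> real" and b b' :: "real ^ 'm" and x y
    assume conv: "\<And>t. convex_on UNIV (f t)" and close: "\<And>j. \<bar>b $ j - b' $ j\<bar> \<le> \<delta>"
      and opt: "is_arg_min (separable f) (\<lambda>z. G *v z \<le> b) x"
      and y: "G *v y \<le> b'" and far: "K < norm1 (y - x)"
    obtain e where e: "e \<noteq> 0"
        "\<And>t. 0 \<le> e $ t \<and> e $ t \<le> y $ t - x $ t \<or> y $ t - x $ t \<le> e $ t \<and> e $ t \<le> 0"
        "\<And>j. (G *v e) $ j = 0 \<or>
          \<delta> \<le> (G *v e) $ j \<and> 0 \<le> (G *v e) $ j \<and> 2 * (G *v e) $ j \<le> (G *v y) $ j - (G *v x) $ j \<or>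
          (G *v e) $ j \<le> - \<delta> \<and> (G *v e) $ j \<le> 0 \<and> (G *v y) $ j - (G *v x) $ j \<le> 2 * (G *v e) $ j"
      using K(2)[OF far] by (auto simp: matrix_vector_mult_diff_distrib)
    have x_le: "(G *v x) $ j \<le> b $ j" and y_le: "(G *v y) $ j \<le> b' $ j" for j
      using opt y by (auto simp: is_arg_min_def less_eq_vec_def)
    \<comment> \<open>If the row grows along \<open>e\<close>, its value at \<open>x + e\<close> is
      at most that at \<open>y - e\<close>, hence at most \<open>b' $ j - \<delta>\<close> and so at
      most \<open>b $ j\<close>; otherwise feasibility of \<open>x\<close> suffices. The claim for
      \<open>y - e\<close> mirrors this.\<close>
    have "(G *v (x + e)) $ j \<le> b $ j" for j
      using e(3)[of j] close[of j] x_le[of j] y_le[of j]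
      unfolding matrix_vector_right_distrib vector_add_component by linarith
    then have "G *v (x + e) \<le> b" by (simp add: less_eq_vec_def)
    then have "separable f x \<le> separable f (x + e)"
      using opt by (auto simp: is_arg_min_linorder)
    moreover have "(G *v (y - e)) $ j \<le> b' $ j" for j
      using e(3)[of j] close[of j] x_le[of j] y_le[of j]
      unfolding matrix_vector_mult_diff_distrib vector_minus_component by linarith
    then have "G *v (y - e) \<le> b'" by (simp add: less_eq_vec_def)
    moreover have "separable f (x + e) + separable f (y - e) \<le> separable f x + separable f y"
      unfolding separable_def sum.distrib[symmetric] vector_add_component vector_minus_component
      by (intro sum_mono convex_on_shift_inwards[OF conv] e(2))
    moreover have "norm1 (y - e - x) < norm1 (y - x)"
      unfolding norm1_def
    proof (rule sum_strict_mono_ex1)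
      have *: "\<bar>(y - e - x) $ t\<bar> = \<bar>(y - x) $ t\<bar> - \<bar>e $ t\<bar>" for t
        using e(2)[of t] by auto
      then show "\<forall>t\<in>UNIV. \<bar>(y - e - x) $ t\<bar> \<le> \<bar>(y - x) $ t\<bar>" by simp
      obtain t where "e $ t \<noteq> 0" using e(1) by (auto simp: vec_eq_iff)
      then show "\<exists>t\<in>UNIV. \<bar>(y - e - x) $ t\<bar> < \<bar>(y - x) $ t\<bar>"
        using *[of t] by (intro bexI[of _ t]) auto
    qed simp
    ultimately show "\<exists>z. G *v z \<le> b' \<and> separable f z \<le> separable f y \<and> norm1 (z - x) < norm1 (y - x)"
      by (intro exI[of _ "y - e"]) auto
  qed
qed

lemma continuous_on_separable:
  assumes "\<And>t. continuous_on UNIV (f t)"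
  shows "continuous_on A (separable f)"
  unfolding separable_def
  by (intro continuous_on_sum continuous_on_compose2[OF assms]) (auto intro: continuous_intros)

lemma closed_matrix_le: "closed {z. G *v z \<le> (b :: real ^ 'm::finite)}"
  unfolding less_eq_vec_def Collect_all_eq
  by (intro closed_INT ballI closed_Collect_le continuous_intros matrix_vector_mult_linear_continuous_on)

lemma compact_norm1_ball:
  assumes "closed A" shows "compact {z\<in>A. norm1 (z - x) \<le> K}"
proof -
  have "closed {z. norm1 (z - x) \<le> K}"
    by (intro closed_Collect_le continuous_on_norm1 continuous_intros)
  moreover have "bounded {z\<in>A. norm1 (z - x) \<le> K}"
  proof (rule bounded_subset[of "cball x K"])
    show "{z\<in>A. norm1 (z - x) \<le> K} \<subseteq> cball x K"
      using norm_le_norm1 order_trans by (fastforce simp: dist_norm norm_minus_commute)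
  qed simp
  ultimately show ?thesis
    using assms by (simp add: compact_eq_bounded_closed Collect_conj_eq closed_Int)
qed

text \<open>The feasible set may be unbounded, but each feasible point can be replaced by one of no
  larger cost in a fixed ball about \<open>x\<close>. On that ball compactness gives a minimiser,
  which is then a global one.\<close>

lemma separable_proximity:
  fixes G :: "real ^ 't::finite ^ 'm::finite"
  obtains K where "0 \<le> K"
    "\<And>(f :: 't \<Rightarrow> real \<Rightarrow> real) (b :: real ^ 'm) b' x. (\<And>t. convex_on UNIV (f t)) \<Longrightarrow> (\<And>t. continuous_on UNIV (f t)) \<Longrightarrow>
      (\<And>j. \<bar>b $ j - b' $ j\<bar> \<le> \<delta>) \<Longrightarrow> \<exists>z. G *v z \<le> b' \<Longrightarrow>
      is_arg_min (separable f) (\<lambda>z. G *v z \<le> b) x \<Longrightarrow>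
      \<exists>y. is_arg_min (separable f) (\<lambda>z. G *v z \<le> b') y \<and> norm1 (y - x) \<le> K"
proof -
  obtain K where K: "0 \<le> K"
    "\<And>(f :: 't \<Rightarrow> real \<Rightarrow> real) b b' x y. (\<And>t. convex_on UNIV (f t)) \<Longrightarrow> (\<And>j. \<bar>b $ j - b' $ j\<bar> \<le> \<delta>) \<Longrightarrow>
      is_arg_min (separable f) (\<lambda>z. G *v z \<le> b) x \<Longrightarrow> G *v y \<le> b' \<Longrightarrow> K < norm1 (y - x) \<Longrightarrow>
      \<exists>z. G *v z \<le> b' \<and> separable f z \<le> separable f y \<and> norm1 (z - x) < norm1 (y - x)"
    using separable_closer_point[where G = G and \<delta> = \<delta>] by metis
  show ?thesis
  proof (rule that[OF K(1)])
    fix f :: "'t \<Rightarrow> real \<Rightarrow> real" and b b' :: "real ^ 'm" and x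
    assume conv: "\<And>t. convex_on UNIV (f t)" and cont: "\<And>t. continuous_on UNIV (f t)"
      and close: "\<And>j. \<bar>b $ j - b' $ j\<bar> \<le> \<delta>" and ne: "\<exists>z. G *v z \<le> b'"
      and opt: "is_arg_min (separable f) (\<lambda>z. G *v z \<le> b) x"
    have near: "\<exists>z. G *v z \<le> b' \<and> separable f z \<le> separable f y \<and> norm1 (z - x) \<le> K"
      if y: "G *v y \<le> b'" for y
    proof -
      \<comment> \<open>A point of \<open>A\<close> nearest to \<open>x\<close> exists. Were it
        farther away than \<open>K\<close>, the previous lemma would produce a nearer point of
        \<open>A\<close>.\<close>
      define A where "A = {z. G *v z \<le> b'} \<inter> {z. separable f z \<le> separable f y}"
      have "closed A"
        unfolding A_def
        by (intro closed_Int closed_matrix_le closed_Collect_le continuous_on_separable cont continuous_intros)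
      then have "compact {z\<in>A. norm1 (z - x) \<le> norm1 (y - x)}" by (rule compact_norm1_ball)
      moreover have "y \<in> {z\<in>A. norm1 (z - x) \<le> norm1 (y - x)}" using y by (simp add: A_def)
      ultimately obtain z where z: "z \<in> A" "norm1 (z - x) \<le> norm1 (y - x)"
        "\<And>w. w \<in> A \<Longrightarrow> norm1 (w - x) \<le> norm1 (y - x) \<Longrightarrow> norm1 (z - x) \<le> norm1 (w - x)"
        using continuous_attains_inf[OF _ _ continuous_on_norm1, of "{z\<in>A. norm1 (z - x) \<le> norm1 (y - x)}" x]
        by blast
      have "norm1 (z - x) \<le> K"
      proof (rule ccontr)
        assume "\<not> norm1 (z - x) \<le> K"
        then obtain w where "G *v w \<le> b'" "separable f w \<le> separable f z" "norm1 (w - x) < norm1 (z - x)"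
          using K(2)[OF conv close opt, of z] z(1) by (auto simp: A_def)
        then show False using z(1,2) z(3)[of w] by (auto simp: A_def)
      qed
      then show ?thesis using z(1) by (auto simp: A_def)
    qed
    let ?B = "{z \<in> {z. G *v z \<le> b'}. norm1 (z - x) \<le> K}"
    have "compact ?B" by (intro compact_norm1_ball closed_matrix_le)
    have "?B \<noteq> {}" using ne near by auto
    obtain y where y: "y \<in> ?B" "\<forall>z\<in>?B. separable f y \<le> separable f z"
      using continuous_attains_inf[OF \<open>compact ?B\<close> \<open>?B \<noteq> {}\<close>
        continuous_on_separable[where f = f, OF cont]]
      by (elim bexE)
    have "separable f y \<le> separable f z" if "G *v z \<le> b'" for z
      using near[OF that] y(2) by fastforce
    then show "\<exists>y. is_arg_min (separable f) (\<lambda>z. G *v z \<le> b') y \<and> norm1 (y - x) \<le> K"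
      using y(1) by (auto simp: is_arg_min_linorder)
  qed
qed

section \<open>Farkas' lemma and the multiplier system\<close>

lemma farkas:
  fixes a :: "'j \<Rightarrow> 'a::euclidean_space"
  assumes "finite J" and "\<And>d. (\<And>j. j \<in> J \<Longrightarrow> a j \<bullet> d \<le> 0) \<Longrightarrow> c \<bullet> d \<le> 0"
  obtains \<mu> where "\<And>j. j \<in> J \<Longrightarrow> 0 \<le> \<mu> j" "c = (\<Sum>j\<in>J. \<mu> j *\<^sub>R a j)"
proof -
  let ?H = "convex_cone hull (a ` J)"
  let ?K = "{\<Sum>j\<in>J. \<mu> j *\<^sub>R a j | \<mu>. \<forall>j\<in>J. 0 \<le> \<mu> j}"
  \<comment> \<open>A finitely generated cone is closed, so a point outside it is strictly separated
    from it; the negated normal then violates the assumption on \<open>c\<close>.\<close>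
  have "c \<in> ?H"
  proof (rule ccontr)
    assume "c \<notin> ?H"
    moreover have "closed ?H" using assms(1) by (simp add: closed_convex_cone_hull)
    ultimately obtain d \<beta> where d: "d \<bullet> c < \<beta>" "\<And>x. x \<in> ?H \<Longrightarrow> \<beta> < d \<bullet> x"
      using separating_hyperplane_closed_point[OF convex_convex_cone_hull] by metis
    have "\<beta> < 0" using d(2)[OF convex_cone_hull_contains_0] by simp
    have "a j \<bullet> (- d) \<le> 0" if "j \<in> J" for j
    proof (rule ccontr)
      assume "\<not> a j \<bullet> (- d) \<le> 0"
      then have neg: "d \<bullet> a j < 0" by (simp add: inner_commute)
      \<comment> \<open>This multiple of \<open>a j\<close> lies exactly on the separating
        hyperplane, while the cone lies strictly to one side of it.\<close>
      have "(\<beta> / (d \<bullet> a j)) *\<^sub>R a j \<in> ?H"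
        using that neg \<open>\<beta> < 0\<close> by (intro convex_cone_hull_mul hull_inc) (auto simp: divide_nonpos_neg)
      from d(2)[OF this] show False using neg by simp
    qed
    then have "c \<bullet> (- d) \<le> 0" by (rule assms(2))
    then show False using d(1) \<open>\<beta> < 0\<close> by (simp add: inner_commute)
  qed
  moreover have "?H \<subseteq> ?K"
  proof (rule hull_minimal)
    show "a ` J \<subseteq> ?K"
    proof clarify
      fix k assume "k \<in> J"
      then have "a k = (\<Sum>j\<in>J. (if j = k then 1 else 0) *\<^sub>R a j)"
        using assms(1) by (simp add: if_distrib[of "\<lambda>c. c *\<^sub>R _"] cong: if_cong)
      then show "\<exists>\<mu>. a k = (\<Sum>j\<in>J. \<mu> j *\<^sub>R a j) \<and> (\<forall>j\<in>J. 0 \<le> \<mu> j)"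
        by (intro exI[of _ "\<lambda>j. if j = k then 1 else 0"]) simp
    qed
    show "convex_cone ?K"
      unfolding convex_cone_iff
    proof (intro conjI ballI allI impI)
      show "0 \<in> ?K" by (auto intro!: exI[of _ "\<lambda>_. 0"])
    next
      fix x y assume "x \<in> ?K" "y \<in> ?K"
      then obtain \<mu> \<nu> where "x = (\<Sum>j\<in>J. \<mu> j *\<^sub>R a j)" "\<forall>j\<in>J. 0 \<le> \<mu> j"
          "y = (\<Sum>j\<in>J. \<nu> j *\<^sub>R a j)" "\<forall>j\<in>J. 0 \<le> \<nu> j"
        by blast
      then show "x + y \<in> ?K"
        by (intro CollectI exI[of _ "\<lambda>j. \<mu> j + \<nu> j"]) (auto simp: scaleR_add_left sum.distrib)
    next
      fix x and r :: real assume "x \<in> ?K" "0 \<le> r"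
      then obtain \<mu> where "x = (\<Sum>j\<in>J. \<mu> j *\<^sub>R a j)" "\<forall>j\<in>J. 0 \<le> \<mu> j" by blast
      then show "r *\<^sub>R x \<in> ?K"
        using \<open>0 \<le> r\<close> by (intro CollectI exI[of _ "\<lambda>j. r * \<mu> j"]) (auto simp: scaleR_sum_right)
    qed
  qed
  ultimately show ?thesis using that by blast
qed

text \<open>Tangent inequalities and stationarity bound \<open>separable f y - separable f x\<close>
  below by \<open>- (\<mu> \<bullet> (G *v (y - x)))\<close>. Complementarity replaces
  \<open>G *v x\<close> by \<open>b\<close> here, and feasibility of \<open>y\<close> makes the
  bound nonnegative.\<close>

lemma kkt_sufficient:
  fixes G :: "real ^ 't::finite ^ 'm::finite"
  assumes conv: "\<And>t. convex_on UNIV (f t)"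
    and diff: "\<And>t. (f t has_real_derivative f' t) (at (x $ t))"
    and stat: "\<And>t. f' t + \<mu> \<bullet> column t G = 0"
    and compl: "complementary \<mu> (b - G *v x)"
  shows "is_arg_min (separable f) (\<lambda>z. G *v z \<le> b) x"
proof -
  have \<mu>: "\<And>j. 0 \<le> \<mu> $ j" and x: "G *v x \<le> b" and orth: "\<mu> \<bullet> (b - G *v x) = 0"
    using compl by (auto simp: complementary_def less_eq_vec_def)
  have "separable f x \<le> separable f y" if y: "G *v y \<le> b" for y
  proof -
    have "\<mu> \<bullet> (G *v (y - x)) = (\<Sum>t\<in>UNIV. (\<mu> \<bullet> column t G) * (y - x) $ t)"
      by (simp add: matrix_mult_sum inner_sum_right scalar_mult_eq_scaleR mult.commute)
    then have "- (\<mu> \<bullet> (G *v (y - x))) = (\<Sum>t\<in>UNIV. f' t * (y $ t - x $ t))"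
      using stat by (simp add: eq_neg_iff_add_eq_0[symmetric] sum_negf)
    also have "\<dots> \<le> (\<Sum>t\<in>UNIV. f t (y $ t) - f t (x $ t))"
      using conv diff by (intro sum_mono convex_on_imp_above_tangent[where A = UNIV]) auto
    also have "\<dots> = separable f y - separable f x"
      by (simp add: separable_def sum_subtractf)
    finally have "separable f x \<le> separable f y + \<mu> \<bullet> (G *v (y - x))" by simp
    moreover have "\<mu> \<bullet> (G *v (y - x)) = \<mu> \<bullet> (G *v y - b)"
      using orth by (simp add: matrix_vector_mult_diff_distrib inner_diff_right)
    moreover have "\<mu> \<bullet> (G *v y - b) \<le> 0"
      unfolding inner_vec_def using \<mu> y
      by (intro sum_nonpos) (auto simp: less_eq_vec_def mult_nonneg_nonpos)
    ultimately show ?thesis by simp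
  qed
  then show ?thesis using x by (simp add: is_arg_min_linorder)
qed

text \<open>The constraints are affine, so a direction that increases no active row stays feasible
  for small steps and cannot be a descent direction. Farkas' lemma then writes the negative gradient
  as a nonnegative combination of the active rows.\<close>

lemma kkt_necessary:
  fixes G :: "real ^ 't::finite ^ 'm::finite"
  assumes diff: "\<And>t. (f t has_real_derivative f' t) (at (x $ t))"
    and opt: "is_arg_min (separable f) (\<lambda>z. G *v z \<le> b) x"
  obtains \<mu> where "\<And>t. f' t + \<mu> \<bullet> column t G = 0" "complementary \<mu> (b - G *v x)"
proof -
  have x: "(G *v x) $ j \<le> b $ j" for j
    using opt by (auto simp: is_arg_min_def less_eq_vec_def)
  define J where "J = {j. (G *v x) $ j = b $ j}"
  have "- (\<chi> t. f' t) \<bullet> d \<le> 0" if d: "\<And>j. j \<in> J \<Longrightarrow> row j G \<bullet> d \<le> 0" for d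
  proof (rule ccontr)
    assume "\<not> - (\<chi> t. f' t) \<bullet> d \<le> 0"
    then have neg: "(\<Sum>t\<in>UNIV. f' t * d $ t) < 0"
      by (simp add: inner_vec_def sum_negf)
    have d': "(G *v d) $ j \<le> 0" if "j \<in> J" for j
      using d[OF that] by (simp add: matrix_vector_mul_component row_def)
    have "((\<lambda>s. f t (x $ t + s * d $ t)) has_real_derivative f' t * d $ t) (at 0)" for t
      by (rule DERIV_chain2[where f = "f t"]) (use diff[of t] in \<open>auto intro!: derivative_eq_intros\<close>)
    then have "((\<lambda>s. separable f (x + s *\<^sub>R d)) has_real_derivative (\<Sum>t\<in>UNIV. f' t * d $ t)) (at 0)"
      unfolding separable_def by (auto intro!: derivative_eq_intros)
    from DERIV_neg_dec_right[OF this neg] obtain \<epsilon> where \<epsilon>: "\<epsilon> > 0"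
      "\<And>s. 0 < s \<Longrightarrow> s < \<epsilon> \<Longrightarrow> separable f (x + s *\<^sub>R d) < separable f x"
      by auto
    \<comment> \<open>Active rows hold for every positive step, inactive ones by continuity for
      small steps; finitely many rows admit a common step.\<close>
    have "\<forall>\<^sub>F s in at_right 0. \<forall>j. (G *v (x + s *\<^sub>R d)) $ j \<le> b $ j"
    proof (rule eventually_all_finite)
      fix j
      show "\<forall>\<^sub>F s in at_right 0. (G *v (x + s *\<^sub>R d)) $ j \<le> b $ j"
      proof (cases "j \<in> J")
        case True
        then have "(G *v (x + s *\<^sub>R d)) $ j \<le> b $ j" if "0 < s" for s
          using d'[OF True] that x[of j]
          using mult_nonneg_nonpos[of s "(G *v d) $ j"]
          by (simp add: matrix_vector_right_distrib matrix_vector_mult_scaleR)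
        then show ?thesis by (auto simp: eventually_at_right_less eventually_at_filter)
      next
        case False
        then have "(G *v x) $ j + 0 * (G *v d) $ j < b $ j" using x[of j] by (simp add: J_def)
        moreover have "((\<lambda>s. (G *v x) $ j + s * (G *v d) $ j) \<longlongrightarrow> (G *v x) $ j + 0 * (G *v d) $ j) (at_right 0)"
          by (intro tendsto_intros)
        ultimately have "\<forall>\<^sub>F s in at_right 0. (G *v x) $ j + s * (G *v d) $ j < b $ j"
          by (metis order_tendstoD(2))
        then show ?thesis
          by eventually_elim (simp add: matrix_vector_right_distrib matrix_vector_mult_scaleR)
      qed
    qed
    moreover have "\<forall>\<^sub>F s in at_right 0. 0 < s \<and> s < \<epsilon>"
      using \<epsilon>(1) eventually_at_right[of 0 1 "\<lambda>s::real. 0 < s \<and> s < \<epsilon>"] by auto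
    ultimately have "\<forall>\<^sub>F s in at_right (0::real). False"
    proof eventually_elim
      case (elim s)
      then have "separable f x \<le> separable f (x + s *\<^sub>R d)"
        using opt by (simp add: is_arg_min_linorder less_eq_vec_def)
      then show ?case using \<epsilon>(2)[of s] elim by simp
    qed
    then show False by simp
  qed
  then obtain \<nu> where \<nu>: "\<And>j. j \<in> J \<Longrightarrow> 0 \<le> \<nu> j" "- (\<chi> t. f' t) = (\<Sum>j\<in>J. \<nu> j *\<^sub>R row j G)"
    using farkas[of J "\<lambda>j. row j G" "- (\<chi> t. f' t)"] by auto
  \<comment> \<open>Extension by zero to the inactive rows, so that every term of the
    complementarity product vanishes.\<close>
  define \<mu> where "\<mu> = (\<chi> j. if j \<in> J then \<nu> j else 0)"
  show ?thesis
  proof (rule that)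
    fix t
    have "- f' t = (\<Sum>j\<in>J. \<nu> j * G $ j $ t)"
      using arg_cong[OF \<nu>(2), of "\<lambda>v. v $ t"] by (simp add: row_def)
    also have "\<dots> = (\<Sum>j\<in>UNIV. if j \<in> J then \<nu> j * G $ j $ t else 0)"
      by (simp add: sum.If_cases)
    also have "\<dots> = \<mu> \<bullet> column t G"
      unfolding inner_vec_def by (intro sum.cong) (auto simp: \<mu>_def column_def)
    finally show "f' t + \<mu> \<bullet> column t G = 0" by simp
  next
    have "\<mu> \<bullet> (b - G *v x) = 0"
      unfolding inner_vec_def by (intro sum.neutral) (auto simp: \<mu>_def J_def)
    then show "complementary \<mu> (b - G *v x)"
      using \<nu>(1) x by (auto simp: complementary_def less_eq_vec_def \<mu>_def)
  qed
qed

section \<open>Mismatch of commitments and shift of the right-hand side\<close>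

lemma mismatch_nonneg: "binary_vector w \<Longrightarrow> 0 \<le> mismatch v w"
proof -
  assume "binary_vector w"
  then have "0 \<le> w $ t" "0 \<le> 1 - w $ t" for t
    by (auto simp: binary_vector_def dest!: spec[of _ t])
  then show ?thesis
    unfolding mismatch_def by (intro add_nonneg_nonneg sum_nonneg)
qed

lemma mismatch_self: "mismatch v v = 0"
  by (simp add: mismatch_def)

text \<open>Between binary vectors \<open>mismatch\<close> is the Hamming distance, so a big-M bound
  is relaxed by at least the full constant as soon as the commitments differ.\<close>

lemma mismatch_ge_1:
  assumes v: "binary_vector v" and w: "binary_vector w" and ne: "v \<noteq> w"
  shows "1 \<le> mismatch v w"
proof -
  obtain s where s: "v $ s \<noteq> w $ s" using ne by (auto simp: vec_eq_iff)
  have bin: "v $ t = 0 \<or> v $ t = 1" "w $ t = 0 \<or> w $ t = 1" for t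
    using v w by (auto simp: binary_vector_def)
  have nonneg: "0 \<le> w $ t" "0 \<le> 1 - w $ t" for t using bin(2)[of t] by auto
  consider "v $ s = 1" "w $ s = 0" | "v $ s = 0" "w $ s = 1" using s bin[of s] by auto
  then show ?thesis
  proof cases
    case 1
    then have "1 - w $ s \<le> (\<Sum>s | v $ s = 1. 1 - w $ s)"
      using nonneg by (intro member_le_sum) auto
    moreover have "0 \<le> (\<Sum>s | v $ s = 0. w $ s)" using nonneg by (intro sum_nonneg) auto
    ultimately show ?thesis using 1 by (simp add: mismatch_def)
  next
    case 2
    then have "w $ s \<le> (\<Sum>s | v $ s = 0. w $ s)"
      using nonneg by (intro member_le_sum) auto
    moreover have "0 \<le> (\<Sum>s | v $ s = 1. 1 - w $ s)" using nonneg by (intro sum_nonneg) auto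
    ultimately show ?thesis using 2 by (simp add: mismatch_def)
  qed
qed

text \<open>Supplies the \<open>\<delta>\<close> of the proximity lemma: exchanging the commitment
  shifts the right-hand side of the dispatch problem by an amount controlled by \<open>H\<close>
  alone.\<close>

lemma binary_rhs_bound:
  fixes H :: "real ^ 't::finite ^ 'm::finite"
  assumes v: "binary_vector v" and w: "binary_vector w"
  shows "\<bar>(h - H *v v) $ j - (h - H *v w) $ j\<bar> \<le> (\<Sum>k\<in>UNIV. norm1 (H $ k))"
proof -
  have diff1: "\<bar>w $ t - v $ t\<bar> \<le> 1" for t
    using v w unfolding binary_vector_def by (metis abs_0 abs_1 abs_minus_commute diff_0_right diff_self insertE singletonD zero_le_one order_refl)
  have "(h - H *v v) $ j - (h - H *v w) $ j = (\<Sum>t\<in>UNIV. H $ j $ t * (w $ t - v $ t))"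
    by (simp add: matrix_vector_mult_def sum_subtractf algebra_simps)
  also have "\<bar>\<dots>\<bar> \<le> (\<Sum>t\<in>UNIV. \<bar>H $ j $ t * (w $ t - v $ t)\<bar>)" by (rule sum_abs)
  also have "\<dots> \<le> norm1 (H $ j)"
    unfolding norm1_def abs_mult using diff1 by (intro sum_mono mult_left_le) auto
  also have "\<dots> \<le> (\<Sum>k\<in>UNIV. norm1 (H $ k))"
    by (rule member_le_sum) (auto simp: norm1_nonneg)
  finally show ?thesis .
qed

section \<open>Equilibria as solutions of the big-M multiplier system\<close>

theorem proposition3:
  fixes P :: "'i::finite \<Rightarrow> 't::finite \<Rightarrow> real \<Rightarrow> ('i \<Rightarrow> real) \<Rightarrow> real"
    and C :: "'i \<Rightarrow> real \<Rightarrow> real"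
    and S :: "'i \<Rightarrow> real ^ 't \<Rightarrow> real"
    and G H :: "'i \<Rightarrow> real ^ 't ^ 'm::finite"
    and h :: "'i \<Rightarrow> real ^ 'm"
    and A :: "'i \<Rightarrow> real ^ 't ^ 'n::finite"
    and b :: "'i \<Rightarrow> real ^ 'n"
    and L :: "'i \<Rightarrow> nat"
    and U :: "'i \<Rightarrow> nat \<Rightarrow> real ^ 't"
  assumes P_concave: "\<And>i t y. y \<in> extensional (- {i}) \<Longrightarrow> concave_on UNIV (\<lambda>x. P i t x y)"
    and P_C1: "\<And>i t y. y \<in> extensional (- {i}) \<Longrightarrow> (\<lambda>x. P i t x y) C1_differentiable_on UNIV"
    and C_convex: "\<And>i. convex_on UNIV (C i)"
    and C_C1: "\<And>i. C i C1_differentiable_on UNIV"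
    and S_continuous: "\<And>i. continuous_on UNIV (S i)"
    and solvable: "\<And>i q. \<exists>x v. producer_optimal P C S G H h A b i q x v"
    and dispatch_feasible:
      "\<And>i v. v \<in> commitments A b i \<Longrightarrow> \<exists>x. producer_feasible G H h A b i x v"
    and enumeration: "\<And>i. bij_betw (U i) {1..L i} (commitments A b i)"
  shows "\<exists>M\<^sub>0::real. \<forall>Mlo Mup :: 'i \<Rightarrow> nat \<Rightarrow> real.
    (\<forall>i. \<forall>l\<in>{1..L i}. M\<^sub>0 \<le> Mlo i l \<and> M\<^sub>0 \<le> Mup i l) \<longrightarrow>
    (\<forall>q u :: 'i \<Rightarrow> real ^ 't.
      uc_nash_equilibrium P C S G H h A b q u \<longleftrightarrow>
      (\<forall>i. G i *v q i + H i *v u i \<le> h i \<and> A i *v u i \<le> b i \<and> binary_vector (u i)) \<and>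
      (\<exists>(ql :: 'i \<Rightarrow> nat \<Rightarrow> real ^ 't) (lam :: 'i \<Rightarrow> nat \<Rightarrow> real ^ 'm).
        \<forall>i. \<forall>l\<in>{1..L i}.
          profit P C S i q (q i) (u i) \<ge> profit P C S i q (ql i l) (U i l) \<and>
          (\<forall>t. - deriv (\<lambda>x. P i t x (rivals i t q)) (ql i l $ t) + deriv (C i) (ql i l $ t)
                + lam i l \<bullet> column t (G i) = 0) \<and>
          complementary (lam i l) (h i - G i *v ql i l - H i *v U i l) \<and>
          (\<forall>t. ql i l $ t - Mlo i l * mismatch (U i l) (u i) \<le> q i $ t \<and>
                q i $ t \<le> ql i l $ t + Mup i l * mismatch (U i l) (u i))))"
proof -
  \<comment> \<open>With the rivals frozen, the profit is, up to sign, this cost summed over time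
    plus \<open>S i\<close>, which is constant once the commitment is fixed.\<close>
  define f where "f i q t x = C i x - P i t x (rivals i t q)" for i q t x
  have ext: "rivals i t q \<in> extensional (- {i})" for i t and q :: "'i \<Rightarrow> real ^ 't"
    by (simp add: rivals_def)
  have f_convex: "convex_on UNIV (f i q t)" for i q t
    unfolding f_def using convex_on_diff[OF C_convex P_concave[OF ext]] .
  have C1_deriv: "(g has_real_derivative deriv g x) (at x)" if "g C1_differentiable_on UNIV"
    for g :: "real \<Rightarrow> real" and x
    using that by (metis C1_differentiable_on_def DERIV_imp_deriv UNIV_I
        has_real_derivative_iff_has_vector_derivative)
  define f' where "f' i q t x = deriv (C i) x - deriv (\<lambda>x. P i t x (rivals i t q)) x" for i q t x
  have f_deriv: "(f i q t has_real_derivative f' i q t x) (at x)" for i q t x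
    unfolding f_def f'_def by (intro DERIV_diff C1_deriv C_C1 P_C1 ext)
  have f_cont: "continuous_on UNIV (f i q t)" for i q t
    using f_deriv by (meson DERIV_isCont continuous_at_imp_continuous_on)
  have profit_eq: "profit P C S i q x v = - separable (f i q) x - S i v" for i q x v
    by (simp add: profit_def separable_def f_def sum_subtractf)
  have U_commitments: "U i l \<in> commitments A b i" if "l \<in> {1..L i}" for i l
    using bij_betwE[OF enumeration] that by blast
  have U_binary: "binary_vector (U i l)" if "l \<in> {1..L i}" for i l
    using U_commitments[OF that] by (simp add: commitments_def)
  \<comment> \<open>The order of quantifiers matters: \<open>K\<close> is chosen before the profile
    \<open>q\<close>, which enters only through the cost functions.\<close>
  have "\<exists>K\<ge>0. \<forall>q (b' :: real ^ 'm) b'' x. (\<forall>j. \<bar>b' $ j - b'' $ j\<bar> \<le> (\<Sum>k\<in>UNIV. norm1 (H i $ k))) \<longrightarrow>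
      (\<exists>z. G i *v z \<le> b'') \<longrightarrow> is_arg_min (separable (f i q)) (\<lambda>z. G i *v z \<le> b') x \<longrightarrow>
      (\<exists>y. is_arg_min (separable (f i q)) (\<lambda>z. G i *v z \<le> b'') y \<and> norm1 (y - x) \<le> K)" for i
  proof (rule separable_proximity[where G = "G i" and \<delta> = "\<Sum>k\<in>UNIV. norm1 (H i $ k)"], goal_cases)
    case (1 K)
    show ?case
    proof (intro exI[of _ K] conjI allI impI 1(1))
      fix q and b' :: "real ^ 'm" and b'' x
      assume "\<forall>j. \<bar>b' $ j - b'' $ j\<bar> \<le> (\<Sum>k\<in>UNIV. norm1 (H i $ k))" "\<exists>z. G i *v z \<le> b''"
        "is_arg_min (separable (f i q)) (\<lambda>z. G i *v z \<le> b') x"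
      then show "\<exists>y. is_arg_min (separable (f i q)) (\<lambda>z. G i *v z \<le> b'') y \<and> norm1 (y - x) \<le> K"
        by (intro 1(2)[OF f_convex f_cont]) blast+
    qed
  qed
  then obtain K where K: "\<And>i. 0 \<le> K i" "\<And>i q (b' :: real ^ 'm) b'' x.
      (\<And>j. \<bar>b' $ j - b'' $ j\<bar> \<le> (\<Sum>k\<in>UNIV. norm1 (H i $ k))) \<Longrightarrow>
      \<exists>z. G i *v z \<le> b'' \<Longrightarrow> is_arg_min (separable (f i q)) (\<lambda>z. G i *v z \<le> b') x \<Longrightarrow>
      \<exists>y. is_arg_min (separable (f i q)) (\<lambda>z. G i *v z \<le> b'') y \<and> norm1 (y - x) \<le> K i"
    by metis
  have K_le: "K i \<le> sum K UNIV" for i using K(1) by (intro member_le_sum) auto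
  have optimal_iff: "producer_optimal P C S G H h A b i q x v \<longleftrightarrow>
      producer_feasible G H h A b i x v \<and>
      (\<forall>y w. producer_feasible G H h A b i y w \<longrightarrow> profit P C S i q y w \<le> profit P C S i q x v)"
    for i q x v
    by (auto simp: producer_optimal_def is_arg_max_linorder)
  have feasible_iff: "producer_feasible G H h A b i x v \<longleftrightarrow>
      v \<in> commitments A b i \<and> G i *v x \<le> h i - H i *v v" for i x v
    by (auto simp: producer_feasible_def commitments_def algebra_simps)
  \<comment> \<open>The system for one pair \<open>i\<close>, \<open>l\<close> as a relation in
    \<open>y\<close> and \<open>\<mu>\<close>, so that witnesses can be found pair by pair and
    collected by choice.\<close>
  define Q where "Q Mlo Mup q u i l y \<mu> \<longleftrightarrow>
      profit P C S i q (q i) (u i) \<ge> profit P C S i q y (U i l) \<and>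
      (\<forall>t. - deriv (\<lambda>x. P i t x (rivals i t q)) (y $ t) + deriv (C i) (y $ t)
        + \<mu> \<bullet> column t (G i) = 0) \<and>
      complementary \<mu> (h i - G i *v y - H i *v U i l) \<and>
      (\<forall>t. y $ t - Mlo i l * mismatch (U i l) (u i) \<le> q i $ t \<and>
        q i $ t \<le> y $ t + Mup i l * mismatch (U i l) (u i))"
    for Mlo Mup :: "'i \<Rightarrow> nat \<Rightarrow> real" and q u i l y \<mu>
  \<comment> \<open>The witness \<open>sum K UNIV\<close> dominates every \<open>K i\<close>, as all
    of them are nonnegative.\<close>
  have "\<exists>M\<^sub>0::real. \<forall>Mlo Mup :: 'i \<Rightarrow> nat \<Rightarrow> real.
    (\<forall>i. \<forall>l\<in>{1..L i}. M\<^sub>0 \<le> Mlo i l \<and> M\<^sub>0 \<le> Mup i l) \<longrightarrow>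
    (\<forall>q u :: 'i \<Rightarrow> real ^ 't.
      uc_nash_equilibrium P C S G H h A b q u \<longleftrightarrow>
      (\<forall>i. G i *v q i + H i *v u i \<le> h i \<and> A i *v u i \<le> b i \<and> binary_vector (u i)) \<and>
      (\<exists>ql lam. \<forall>i. \<forall>l\<in>{1..L i}. Q Mlo Mup q u i l (ql i l) (lam i l)))"
  proof (intro exI[of _ "sum K UNIV"] allI impI iffI conjI)
    fix Mlo Mup :: "'i \<Rightarrow> nat \<Rightarrow> real" and q u :: "'i \<Rightarrow> real ^ 't"
    assume M: "\<forall>i. \<forall>l\<in>{1..L i}. sum K UNIV \<le> Mlo i l \<and> sum K UNIV \<le> Mup i l"
      and "uc_nash_equilibrium P C S G H h A b q u"
    then have opt: "producer_optimal P C S G H h A b i q (q i) (u i)" for i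
      by (simp add: uc_nash_equilibrium_def)
    then have feas: "producer_feasible G H h A b i (q i) (u i)" for i by (simp add: optimal_iff)
    then show "G i *v q i + H i *v u i \<le> h i" "A i *v u i \<le> b i" "binary_vector (u i)" for i
      by (simp_all add: producer_feasible_def)
    \<comment> \<open>Deviations that keep the commitment \<open>u i\<close> show that
      \<open>q i\<close> solves its own dispatch problem; it is the reference point for the
      proximity lemma.\<close>
    have opt_u: "is_arg_min (separable (f i q)) (\<lambda>z. G i *v z \<le> h i - H i *v u i) (q i)" for i
      unfolding is_arg_min_linorder
    proof (intro conjI allI impI)
      show "G i *v q i \<le> h i - H i *v u i" using feas by (simp add: feasible_iff)
      fix y assume "G i *v y \<le> h i - H i *v u i"
      then have "producer_feasible G H h A b i y (u i)" using feas by (simp add: feasible_iff)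
      then have "profit P C S i q y (u i) \<le> profit P C S i q (q i) (u i)"
        using opt[of i] by (simp add: optimal_iff)
      then show "separable (f i q) (q i) \<le> separable (f i q) y" by (simp add: profit_eq)
    qed
    have Q_ex: "\<exists>y \<mu>. Q Mlo Mup q u i l y \<mu>"
      if l: "l \<in> {1..L i}" for i l
    proof -
      \<comment> \<open>For the own commitment the mismatch is 0, which forces
        \<open>y = q i\<close>. For any other one the proximity lemma gives an optimal dispatch
        within \<open>K i\<close>, and the mismatch is at least 1.\<close>
      obtain y where y: "is_arg_min (separable (f i q)) (\<lambda>z. G i *v z \<le> h i - H i *v U i l) y"
        and near: "norm1 (y - q i) \<le> sum K UNIV * mismatch (U i l) (u i)"
      proof (cases "U i l = u i")
        case True
        then show thesis using opt_u[of i] by (intro that[of "q i"]) (simp_all add: norm1_def mismatch_self)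
      next
        case False
        have bin: "binary_vector (u i)" using feas by (simp add: producer_feasible_def)
        \<comment> \<open>Feasibility of the dispatch for every commitment enters here; proximity
          turns it into an optimal dispatch.\<close>
        have "\<exists>z. G i *v z \<le> h i - H i *v U i l"
          using dispatch_feasible[OF U_commitments[OF l]] by (auto simp: feasible_iff)
        then obtain y where "is_arg_min (separable (f i q)) (\<lambda>z. G i *v z \<le> h i - H i *v U i l) y"
            "norm1 (y - q i) \<le> K i"
          using K(2)[OF binary_rhs_bound[OF bin U_binary[OF l]] _ opt_u] by blast
        moreover have "K i \<le> sum K UNIV * mismatch (U i l) (u i)"
          using K_le[of i] K(1) mismatch_ge_1[OF U_binary[OF l] bin False]
            mult_left_mono[of 1 "mismatch (U i l) (u i)" "sum K UNIV"] sum_nonneg[of UNIV K] by auto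
        ultimately show thesis using that by force
      qed
      obtain \<mu> where \<mu>: "\<And>t. f' i q t (y $ t) + \<mu> \<bullet> column t (G i) = 0"
          "complementary \<mu> (h i - H i *v U i l - G i *v y)"
        using kkt_necessary[OF f_deriv y] by metis
      have "producer_feasible G H h A b i y (U i l)"
        using y U_commitments[OF l] by (simp add: feasible_iff is_arg_min_def)
      then have "profit P C S i q (q i) (u i) \<ge> profit P C S i q y (U i l)"
        using opt[of i] by (simp add: optimal_iff)
      moreover have "y $ t - Mlo i l * mismatch (U i l) (u i) \<le> q i $ t \<and>
          q i $ t \<le> y $ t + Mup i l * mismatch (U i l) (u i)" for t
      proof -
        have "0 \<le> mismatch (U i l) (u i)"
          using feas by (intro mismatch_nonneg U_binary[OF l]) (simp add: producer_feasible_def)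
        then have "sum K UNIV * mismatch (U i l) (u i) \<le> Mlo i l * mismatch (U i l) (u i)"
            "sum K UNIV * mismatch (U i l) (u i) \<le> Mup i l * mismatch (U i l) (u i)"
          using M l by (auto intro: mult_right_mono)
        moreover have "\<bar>y $ t - q i $ t\<bar> \<le> sum K UNIV * mismatch (U i l) (u i)"
          using component_le_norm1[of "y - q i" t] near by simp
        ultimately show ?thesis by linarith
      qed
      moreover have "- deriv (\<lambda>x. P i t x (rivals i t q)) (y $ t) + deriv (C i) (y $ t)
          + \<mu> \<bullet> column t (G i) = 0" for t
        using \<mu>(1)[of t] by (simp add: f'_def)
      moreover have "complementary \<mu> (h i - G i *v y - H i *v U i l)"
        using \<mu>(2) by (simp add: algebra_simps)
      ultimately have "Q Mlo Mup q u i l y \<mu>"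
        unfolding Q_def by (intro conjI allI) simp_all
      then show ?thesis by (intro exI)
    qed
    \<comment> \<open>The dispatch is chosen first because the multiplier must belong to it; values
      at indices outside \<open>{1..L i}\<close> are arbitrary.\<close>
    define ql where "ql i l = (SOME y. \<exists>\<mu>. Q Mlo Mup q u i l y \<mu>)" for i l
    define lam where "lam i l = (SOME \<mu>. Q Mlo Mup q u i l (ql i l) \<mu>)" for i l
    have "Q Mlo Mup q u i l (ql i l) (lam i l)" if "l \<in> {1..L i}" for i l
      unfolding lam_def by (rule someI_ex) (unfold ql_def, rule someI_ex[OF Q_ex[OF that]])
    then show "\<exists>ql lam. \<forall>i. \<forall>l\<in>{1..L i}. Q Mlo Mup q u i l (ql i l) (lam i l)"
      by (intro exI[of _ ql] exI[of _ lam] allI ballI)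
  next
    fix Mlo Mup :: "'i \<Rightarrow> nat \<Rightarrow> real" and q u :: "'i \<Rightarrow> real ^ 't"
    assume asm: "(\<forall>i. G i *v q i + H i *v u i \<le> h i \<and> A i *v u i \<le> b i \<and> binary_vector (u i)) \<and>
      (\<exists>ql lam. \<forall>i. \<forall>l\<in>{1..L i}. Q Mlo Mup q u i l (ql i l) (lam i l))"
    have feas: "producer_feasible G H h A b i (q i) (u i)" for i
      using spec[OF conjunct1[OF asm], of i] by (simp add: producer_feasible_def)
    obtain ql lam where Q: "\<forall>i. \<forall>l\<in>{1..L i}. Q Mlo Mup q u i l (ql i l) (lam i l)"
      using conjunct2[OF asm] by (elim exE)
    have better: "profit P C S i q (ql i l) (U i l) \<le> profit P C S i q (q i) (u i)"
      and stat: "\<forall>t. - deriv (\<lambda>x. P i t x (rivals i t q)) (ql i l $ t) + deriv (C i) (ql i l $ t)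
          + lam i l \<bullet> column t (G i) = 0"
      and compl: "complementary (lam i l) (h i - G i *v ql i l - H i *v U i l)"
      if "l \<in> {1..L i}" for i l
      using bspec[OF spec[OF Q] that] unfolding Q_def by - (elim conjE, assumption)+
    \<comment> \<open>The commitment of a deviation is some \<open>U i l\<close>. The multiplier
      system makes \<open>ql i l\<close> optimal for it, so the deviation earns at most the profit
      at \<open>ql i l\<close>, which the profit inequality compares with
      \<open>q i\<close>.\<close>
    have "profit P C S i q y w \<le> profit P C S i q (q i) (u i)"
      if yw: "producer_feasible G H h A b i y w" for i y w
    proof -
      obtain l where l: "l \<in> {1..L i}" "U i l = w"
        using yw bij_betw_imp_surj_on[OF enumeration, of i] unfolding feasible_iff by (metis imageE)
      have "is_arg_min (separable (f i q)) (\<lambda>z. G i *v z \<le> h i - H i *v w) (ql i l)"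
      proof (rule kkt_sufficient[OF f_convex f_deriv])
        show "f' i q t (ql i l $ t) + lam i l \<bullet> column t (G i) = 0" for t
          using spec[OF stat[OF l(1)], of t] by (simp add: f'_def)
        show "complementary (lam i l) (h i - H i *v w - G i *v ql i l)"
          using compl[OF l(1)] l(2) by (simp add: algebra_simps)
      qed
      then have "profit P C S i q y w \<le> profit P C S i q (ql i l) w"
        using yw by (simp add: is_arg_min_linorder profit_eq feasible_iff)
      then show ?thesis using better[OF l(1)] l(2) by simp
    qed
    then show "uc_nash_equilibrium P C S G H h A b q u"
      using feas by (simp add: uc_nash_equilibrium_def optimal_iff)
  qed
  then show ?thesis unfolding Q_def .
qed

end
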